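(* Let the functions $\alpha_k(s)$ ($k=0,1,2,\ldots$, $s\in\mathbb{C}$) be defined by the Taylor expansion $$\left(\frac{-\log(1-t)}{t}\right)^{s-1}=\sum_{k=0}^\infty \alpha_k(s)\,t^k,\qquad |t|<1.$$ Then $\alpha_0(s)=1$, $\alpha_1(s)=\frac{s-1}{2}$, and for every integer $k\ge1$, $$\alpha_{k+1}(s)=\frac{1}{k(k+1)(k+2)}\sum_{j=1}^k\frac{\alpha_j(s)\,j\,\bigl(k+k^2+s(2k+2-j)\bigr)}{(k-j+1)(k-j+2)}.$$
   Context: For $|t|<1$ let $g(t)=\frac{-\log(1-t)}{t}=\sum_{k=0}^\infty \frac{t^k}{k+1}$ (so $g(0)=1$), which is analytic and non-vanishing on $|t|<1$. For $s\in\mathbb{C}$, $g(t)^{s-1}=\exp((s-1)\log g(t))$ with the branch of $\log g$ that is analytic on $|t|<1$ with $\log g(0)=0$; the $\alpha_k(s)$ are its Taylor coefficients at $t=0$. *)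

theory Defs
  imports "HOL-Complex_Analysis.Complex_Analysis"
begin

definition g :: "complex \<Rightarrow> complex" where
  "g t = (if t = 0 then 1 else - ln (1 - t) / t)"

text \<open>The choice is unique on the unit disc: see \<open>log_g_exists\<close> and \<open>log_g_unique\<close> below.\<close>

definition log_g :: "complex \<Rightarrow> complex" where
  "log_g = (SOME L. L holomorphic_on ball 0 1 \<and> L 0 = 0 \<and> (\<forall>t\<in>ball 0 1. exp (L t) = g t))"

definition g_power :: "complex \<Rightarrow> complex \<Rightarrow> complex" where
  "g_power s t = exp ((s - 1) * log_g t)"

definition alpha :: "nat \<Rightarrow> complex \<Rightarrow> complex" where
  "alpha k s = (deriv ^^ k) (g_power s) 0 / fact k"

lemma one_minus_notin_nonpos_Reals:
  fixes t :: complex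
  assumes "t \<in> ball 0 1"
  shows "1 - t \<notin> \<real>\<^sub>\<le>\<^sub>0"
proof -
  have "Re t < 1"
    using assms complex_Re_le_cmod[of t] by simp
  then show ?thesis
    by (auto simp: complex_nonpos_Reals_iff)
qed

lemma g_holomorphic: "g holomorphic_on ball 0 1"
proof (rule pole_theorem_open_0)
  show "(\<lambda>t. - ln (1 - t)) holomorphic_on ball 0 (1::real)"
    using one_minus_notin_nonpos_Reals by (intro holomorphic_intros) auto
  have "((\<lambda>t::complex. - ln (1 - t)) has_field_derivative 1) (at 0)"
    by (rule derivative_eq_intros refl | simp)+
  then show "g 0 = deriv (\<lambda>t. - ln (1 - t)) 0"
    by (simp add: g_def DERIV_imp_deriv)
qed (auto simp: g_def)

lemma g_nonzero:
  assumes "t \<in> ball 0 1"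
  shows "g t \<noteq> 0"
proof (cases "t = 0")
  case False
  have "1 - t \<noteq> 0"
    using assms by auto
  then have "exp (ln (1 - t)) = 1 - t"
    by simp
  with False have "ln (1 - t) \<noteq> 0"
    by auto
  with False show ?thesis
    by (simp add: g_def)
qed (simp add: g_def)

lemma log_g_exists:
  "\<exists>L. L holomorphic_on ball 0 1 \<and> L 0 = 0 \<and> (\<forall>t\<in>ball 0 1. exp (L t) = g t)"
proof -
  obtain h where h: "h holomorphic_on ball 0 1" "\<And>t. t \<in> ball 0 1 \<Longrightarrow> exp (h t) = g t"
    by (rule holomorphic_logarithm_exists[of "ball 0 1" g 0]) (auto simp: g_holomorphic g_nonzero)
  have "exp (h 0) = 1"
    using h(2)[of 0] by (simp add: g_def)
  then have "(\<lambda>t. h t - h 0) holomorphic_on ball 0 1 \<and> h 0 - h 0 = 0 \<and>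
    (\<forall>t\<in>ball 0 1. exp (h t - h 0) = g t)"
    using h by (auto simp: exp_diff intro!: holomorphic_intros)
  then show ?thesis
    by blast
qed

lemma log_g:
  shows log_g_holomorphic: "log_g holomorphic_on ball 0 1"
    and log_g_0: "log_g 0 = 0"
    and exp_log_g: "t \<in> ball 0 1 \<Longrightarrow> exp (log_g t) = g t"
  using someI_ex[OF log_g_exists] unfolding log_g_def[symmetric] by blast+

lemma log_g_unique:
  assumes "L holomorphic_on ball 0 1" "L 0 = 0" "\<And>t. t \<in> ball 0 1 \<Longrightarrow> exp (L t) = g t"
    and t: "t \<in> ball 0 1"
  shows "L t = log_g t"
proof -
  define D where "D = (\<lambda>t. L t - log_g t)"
  have hol: "D holomorphic_on ball 0 1"
    unfolding D_def using assms(1) log_g_holomorphic by (intro holomorphic_intros)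
  have e: "exp (D x) = 1" if "x \<in> ball 0 1" for x
    using that assms(3) exp_log_g g_nonzero by (simp add: D_def exp_diff)
  have "(D has_field_derivative 0) (at x within ball 0 1)" if x: "x \<in> ball 0 1" for x
  proof -
    have d: "(D has_field_derivative deriv D x) (at x)"
      using hol x by (intro holomorphic_derivI[of D "ball 0 1"]) auto
    have "((\<lambda>x. exp (D x)) has_field_derivative exp (D x) * deriv D x) (at x)"
      by (rule DERIV_chain'[OF d DERIV_exp, THEN DERIV_cong]) simp
    moreover have "((\<lambda>x. exp (D x)) has_field_derivative 0) (at x)"
    proof (rule has_field_derivative_transform_within_open)
      show "((\<lambda>x. 1) has_field_derivative 0) (at x)" by simp
      show "open (ball (0::complex) 1)" "x \<in> ball 0 1" using x by auto
    qed (simp add: e)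
    ultimately have "exp (D x) * deriv D x = 0"
      by (rule DERIV_unique)
    with d show ?thesis
      by (simp add: has_field_derivative_at_within)
  qed
  then obtain c where "\<And>x. x \<in> ball 0 1 \<Longrightarrow> D x = c"
    using has_field_derivative_zero_constant[of "ball 0 1" D] by auto
  then have "D t = D 0"
    using t by simp
  then show ?thesis
    using assms(2) log_g_0 by (simp add: D_def)
qed

lemma alpha_sums:
  assumes "norm t < 1"
  shows "(\<lambda>k. alpha k s * t ^ k) sums g_power s t"
proof -
  have "g_power s holomorphic_on ball 0 1"
    unfolding g_power_def using log_g_holomorphic by (intro holomorphic_intros)
  from holomorphic_power_series[OF this, of t] assms show ?thesis
    by (simp add: alpha_def)
qed

end

theory Submission
  imports Defs
begin

text \<open>
  Put \<open>F = g\<^sup>s\<^sup>-\<^sup>1\<close>. Two first-order equations determine everything: the power rule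
  \<open>g F' = (s - 1) g' F\<close> and \<open>(1 - t) (t g)' = 1\<close>, the latter because \<open>t g = - log (1 - t)\<close>.
  Read as identities of formal power series, they make the recurrence a purely algebraic matter.

  The naive recurrence for powers of a power series compares coefficients in \<open>g F' = (s - 1) g' F\<close>.
  The faster decaying weights \<open>1/((m + 1) (m + 2))\<close> of the theorem come instead from the series
  \<open>1 - (1 - t) g\<close>, whose coefficient at \<open>t\<^sup>m\<^sup>+\<^sup>1\<close> is \<open>1/(m + 1) - 1/(m + 2)\<close>.
  With \<open>Q = (1 - t) g F'\<close> and the Euler operator \<open>\<theta> = t d/dt\<close>, the two equations imply
  \<open>(\<theta> + 1) (\<theta> + s) Q = (s - 1) \<theta> F' + s g F'\<close>
  (lemma \<open>power_ode_coeff_identity\<close>). The \<open>k\<close>-th coefficient of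
  \<open>(k + 1) (k + s) (F' - Q) + s (g F' - F')\<close> therefore collapses to a multiple of the \<open>k\<close>-th
  coefficient of \<open>F'\<close>, while as a convolution it is the sum in the theorem: \<open>F' - Q\<close> and
  \<open>g F' - F'\<close> are the products of \<open>F'\<close> with \<open>1 - (1 - t) g\<close> and \<open>g - 1\<close>, two series
  without constant term, so that only earlier coefficients of \<open>F'\<close> occur in it.
\<close>

section \<open>The recurrence for formal power series\<close>

lemma of_nat_add_neq_0:
  "of_nat m + 1 \<noteq> (0::'a::field_char_0)" "of_nat m + 2 \<noteq> (0::'a)"
  using of_nat_neq_0[of m, where 'a='a] of_nat_neq_0[of "Suc m", where 'a='a]
  by (simp_all add: add.commute)

lemma log_ode_coeff:
  fixes G :: "'a::field_char_0 fps"
  assumes log: "(1 - fps_X) * fps_deriv (fps_X * G) = 1"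
  shows "fps_nth G n = 1 / of_nat (Suc n)"
proof -
  have "fps_deriv (fps_X * G) = inverse (1 - fps_X)"
    by (rule fps_inverse_unique[OF log, symmetric])
  also have "\<dots> = Abs_fps (\<lambda>_. 1)"
    by (simp flip: fps_inverse_gp')
  finally have "fps_nth (fps_deriv (fps_X * G)) n = 1"
    by simp
  then have "of_nat (Suc n) * fps_nth G n = 1"
    by (simp del: fps_deriv_mult)
  then show ?thesis
    by (metis nonzero_mult_div_cancel_left of_nat_neq_0)
qed

text \<open>
  This is \<open>(\<theta> + 1) (\<theta> + s) Q = (s - 1) \<theta> F' + s G F'\<close> for \<open>Q = (1 - X) G F'\<close>, in coefficients.
  Multiplication by \<open>X\<close> eliminates the derivatives from \<open>Q\<close>, since
  \<open>X Q = (s - 1) F (1 - (1 - X) G)\<close>. Differentiating this once gives the coefficients of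
  \<open>(\<theta> + 1) Q = (X Q)'\<close> in two forms: one that contains \<open>Q\<close> itself and the product \<open>G F\<close>, and one
  that contains \<open>(X G F)' = (\<theta> + 1) (G F)\<close> instead. Applying \<open>\<theta> + 1\<close> to the first and
  subtracting the second therefore cancels all terms in the undifferentiated \<open>F\<close>.
\<close>

lemma power_ode_coeff_identity:
  fixes F G :: "'a::field_char_0 fps" and s :: 'a
  assumes power: "G * fps_deriv F = fps_const (s - 1) * (fps_deriv G * F)"
    and log: "(1 - fps_X) * fps_deriv (fps_X * G) = 1"
  shows "(of_nat k + 1) * (of_nat k + s) * fps_nth ((1 - fps_X) * G * fps_deriv F) k =
    (s - 1) * of_nat k * fps_nth (fps_deriv F) k + s * fps_nth (G * fps_deriv F) k"
proof -
  define F' G' Q R a where "F' = fps_deriv F" and "G' = fps_deriv G"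
    and "Q = (1 - fps_X) * G * F'" and "R = fps_X * Q" and "a = fps_const (s - 1)"
  have p: "G * F' = a * (G' * F)"
    using power by (simp add: F'_def G'_def a_def)
  have l: "(1 - fps_X) * (G + fps_X * G') = 1"
    using log by (simp add: G'_def add.commute)
  have "R = a * F * ((1 - fps_X) * (fps_X * G'))"
    unfolding R_def Q_def mult.assoc p by (simp add: algebra_simps)
  also have "(1 - fps_X) * (fps_X * G') = 1 - (1 - fps_X) * G"
    using l by (simp add: algebra_simps)
  finally have R: "R = a * (F - (1 - fps_X) * (G * F))"
    by (simp add: algebra_simps)
  have R'1: "fps_deriv R = a * (F' + G * F) - (1 + a) * Q"
  proof -
    have "fps_deriv R = a * F' + a * (G * F) - (1 - fps_X) * (a * (G' * F)) - a * Q"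
      by (simp add: R Q_def a_def F'_def G'_def algebra_simps)
    also have "(1 - fps_X) * (a * (G' * F)) = Q"
      by (simp add: Q_def mult.assoc flip: p)
    finally show ?thesis
      by (simp add: algebra_simps)
  qed
  have R'2: "fps_deriv R = a * F' + a * fps_deriv (fps_X * (G * F)) - (1 + a) * (G * F')"
  proof -
    have "fps_deriv R = a * F' + a * fps_deriv (fps_X * (G * F)) - (a * (G' * F) + a * (G * F'))"
      by (simp add: R a_def F'_def G'_def algebra_simps)
    also have "a * (G' * F) + a * (G * F') = (1 + a) * (G * F')"
      by (simp add: distrib_right flip: p)
    finally show ?thesis .
  qed
  have a1: "1 + a = fps_const s"
    by (simp add: a_def flip: fps_const_1_eq_1 fps_const_add)
  have X_deriv: "fps_nth (fps_deriv (fps_X * H)) k = (of_nat k + 1) * fps_nth H k" for H :: "'a fps"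
    by (simp add: add.commute del: fps_deriv_mult)
  have e0: "fps_nth (fps_deriv R) k = (of_nat k + 1) * fps_nth Q k"
    by (simp add: R_def X_deriv del: fps_deriv_mult)
  have e1: "(of_nat k + 1) * fps_nth Q k =
      (s - 1) * (fps_nth F' k + fps_nth (G * F) k) - s * fps_nth Q k"
    unfolding e0[symmetric] R'1 a1 by (simp add: a_def)
  have e2: "(of_nat k + 1) * fps_nth Q k = (s - 1) * fps_nth F' k +
      (s - 1) * ((of_nat k + 1) * fps_nth (G * F) k) - s * fps_nth (G * F') k"
    unfolding e0[symmetric] R'2 a1 by (simp add: a_def X_deriv mult.assoc del: fps_deriv_mult)
  have "(of_nat k + 1) * (of_nat k + s) * fps_nth Q k =
      (of_nat k + 1) * ((of_nat k + 1) * fps_nth Q k + s * fps_nth Q k)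
      - (of_nat k + 1) * fps_nth Q k"
    by (simp add: algebra_simps)
  also have "(of_nat k + 1) * fps_nth Q k + s * fps_nth Q k =
      (s - 1) * (fps_nth F' k + fps_nth (G * F) k)"
    using e1 by simp
  also have "(of_nat k + 1) * ((s - 1) * (fps_nth F' k + fps_nth (G * F) k))
      - (of_nat k + 1) * fps_nth Q k =
      (s - 1) * of_nat k * fps_nth F' k + s * fps_nth (G * F') k"
    unfolding e2 by (simp add: algebra_simps)
  finally show ?thesis
    by (simp add: Q_def F'_def)
qed

lemma log_power_recurrence:
  fixes F G :: "'a::field_char_0 fps" and s :: 'a
  assumes power: "G * fps_deriv F = fps_const (s - 1) * (fps_deriv G * F)"
    and log: "(1 - fps_X) * fps_deriv (fps_X * G) = 1"
  shows "(\<Sum>j = 1..k. fps_nth F j * of_nat j *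
            (of_nat k + of_nat k ^ 2 + s * (2 * of_nat k + 2 - of_nat j)) /
            ((of_nat k - of_nat j + 1) * (of_nat k - of_nat j + 2))) =
         of_nat k * (of_nat k + 1) * (of_nat k + 2) * fps_nth F (k + 1)"
proof -
  define F' where "F' = fps_deriv F"
  define A where "A = 1 - (1 - fps_X) * G"
  define B where "B = G - 1"
  define c where "c = (of_nat k + 1) * (of_nat k + s)"
  have G: "fps_nth G n = 1 / of_nat (Suc n)" for n
    by (rule log_ode_coeff[OF log])
  have A0: "fps_nth A 0 = 0" and B0: "fps_nth B 0 = 0"
    by (simp_all add: A_def B_def G)
  have A_Suc: "fps_nth A (Suc m) = 1 / ((of_nat m + 1) * (of_nat m + 2))" for m
  proof -
    have "fps_nth A (Suc m) = 1 / (of_nat m + 1) - 1 / (of_nat m + 2)"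
      by (simp add: A_def G algebra_simps)
    then show ?thesis
      using of_nat_add_neq_0[of m, where 'a='a] by (simp add: divide_simps)
  qed
  have B_Suc: "fps_nth B (Suc m) = 1 / (of_nat m + 2)" for m
    by (simp add: B_def G algebra_simps)
  have summand: "F' $ i * (c * A $ (k - i) + s * B $ (k - i)) =
      F $ Suc i * of_nat (Suc i) *
            (of_nat k + of_nat k ^ 2 + s * (2 * of_nat k + 2 - of_nat (Suc i))) /
            ((of_nat k - of_nat (Suc i) + 1) * (of_nat k - of_nat (Suc i) + 2))"
    if i: "i < k" for i
  proof -
    obtain m where k: "k = i + Suc m"
      using i less_iff_Suc_add by fastforce
    have "c * A $ (k - i) + s * B $ (k - i) =
        c / ((of_nat m + 1) * (of_nat m + 2)) + s / (of_nat m + 2)"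
      by (simp add: k A_Suc B_Suc)
    also have "\<dots> = (c + s * (of_nat m + 1)) / ((of_nat m + 1) * (of_nat m + 2))"
      using of_nat_add_neq_0[of m, where 'a='a] by (simp add: divide_simps)
    also have "c + s * (of_nat m + 1) =
        of_nat k + of_nat k ^ 2 + s * (2 * of_nat k + 2 - of_nat (Suc i))"
      by (simp add: c_def k power2_eq_square algebra_simps)
    also have "of_nat m + 1 = (of_nat k - of_nat (Suc i) + 1 :: 'a)"
      by (simp add: k)
    also have "of_nat m + 2 = (of_nat k - of_nat (Suc i) + 2 :: 'a)"
      by (simp add: k)
    finally show ?thesis
      by (simp add: F'_def algebra_simps)
  qed
  have "(\<Sum>j = 1..k. F $ j * of_nat j *
            (of_nat k + of_nat k ^ 2 + s * (2 * of_nat k + 2 - of_nat j)) /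
            ((of_nat k - of_nat j + 1) * (of_nat k - of_nat j + 2))) =
        (\<Sum>i<k. F' $ i * (c * A $ (k - i) + s * B $ (k - i)))"
    unfolding One_nat_def sum.atLeast1_atMost_eq
    by (intro sum.cong refl summand[symmetric]) simp
  also have "\<dots> = (\<Sum>i=0..k. F' $ i * (c * A $ (k - i) + s * B $ (k - i)))"
    by (simp add: A0 B0 flip: atMost_atLeast0 lessThan_Suc_atMost)
  also have "\<dots> = c * (F' * A) $ k + s * (F' * B) $ k"
    by (simp add: fps_mult_nth sum_distrib_left distrib_left mult.left_commute
        flip: sum.distrib)
  also have "F' * A = F' - (1 - fps_X) * G * F'"
    by (simp add: A_def algebra_simps)
  also have "F' * B = G * F' - F'"
    by (simp add: B_def algebra_simps)
  also have "c * (F' - (1 - fps_X) * G * F') $ k + s * (G * F' - F') $ k =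
      c * F' $ k - c * ((1 - fps_X) * G * F') $ k + s * (G * F') $ k - s * F' $ k"
    by (simp only: fps_sub_nth right_diff_distrib) simp
  also have "c * ((1 - fps_X) * G * F') $ k =
      (s - 1) * of_nat k * F' $ k + s * (G * F') $ k"
    unfolding c_def F'_def by (rule power_ode_coeff_identity[OF power log])
  also have "c * F' $ k - ((s - 1) * of_nat k * F' $ k + s * (G * F') $ k)
      + s * (G * F') $ k - s * F' $ k = of_nat k * (of_nat k + 2) * F' $ k"
    by (simp add: c_def algebra_simps)
  also have "\<dots> = of_nat k * (of_nat k + 1) * (of_nat k + 2) * F $ (k + 1)"
    by (simp add: F'_def algebra_simps)
  finally show ?thesis .
qed

section \<open>The Taylor expansions of g and its powers\<close>

lemma holomorphic_has_fps_expansion: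
  assumes "f holomorphic_on ball 0 1"
  shows "f has_fps_expansion fps_expansion f 0"
  using assms by (intro has_fps_expansion_fps_expansion[of "ball 0 1"]) auto

lemma eventually_in_disc: "eventually (\<lambda>t::complex. t \<in> ball 0 1) (nhds 0)"
  by (intro eventually_nhds_in_open) auto

lemma g_power_holomorphic: "g_power s holomorphic_on ball 0 1"
  unfolding g_power_def using log_g_holomorphic by (intro holomorphic_intros)

text \<open>
  Both \<open>g\<close> (with \<open>c = 1\<close>) and its power (with \<open>c = s - 1\<close>) are exponentials of multiples of the
  same logarithm. Cross-multiplying the two logarithmic derivatives gives the power rule without a
  division by \<open>g\<close>.
\<close>

lemma fps_expansion_log_derivative:
  assumes "f holomorphic_on ball 0 1"
    and "\<And>t. t \<in> ball 0 1 \<Longrightarrow> f t = exp (c * log_g t)"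
  shows "fps_deriv (fps_expansion f 0) =
    fps_const c * fps_deriv (fps_expansion log_g 0) * fps_expansion f 0"
proof (rule fps_expansion_unique_complex)
  note [fps_expansion_intros] = holomorphic_has_fps_expansion[OF assms(1)]
    holomorphic_has_fps_expansion[OF log_g_holomorphic]
  show "deriv f has_fps_expansion fps_deriv (fps_expansion f 0)"
    by (intro fps_expansion_intros)
  have "(\<lambda>t. c * deriv log_g t * f t) has_fps_expansion
      fps_const c * fps_deriv (fps_expansion log_g 0) * fps_expansion f 0"
    by (intro fps_expansion_intros)
  moreover have "deriv f t = c * deriv log_g t * f t" if t: "t \<in> ball 0 1" for t
  proof -
    have "(log_g has_field_derivative deriv log_g t) (at t)"
      using log_g_holomorphic t by (intro holomorphic_derivI[of _ "ball 0 1"]) auto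
    then have "((\<lambda>t. exp (c * log_g t)) has_field_derivative
        exp (c * log_g t) * (c * deriv log_g t)) (at t)"
      by (auto intro!: derivative_eq_intros)
    then have "(f has_field_derivative exp (c * log_g t) * (c * deriv log_g t)) (at t)"
      by (rule has_field_derivative_transform_within_open[where S = "ball 0 1"])
        (use t assms(2) in auto)
    then show ?thesis
      using assms(2)[OF t] by (simp add: DERIV_imp_deriv)
  qed
  ultimately show "deriv f has_fps_expansion
      fps_const c * fps_deriv (fps_expansion log_g 0) * fps_expansion f 0"
    by (subst has_fps_expansion_cong[OF _ refl])
      (auto intro: eventually_mono[OF eventually_in_disc])
qed

lemma fps_expansion_power_ode:
  "fps_expansion g 0 * fps_deriv (fps_expansion (g_power s) 0) =
    fps_const (s - 1) * (fps_deriv (fps_expansion g 0) * fps_expansion (g_power s) 0)"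
proof -
  have "fps_deriv (fps_expansion (g_power s) 0) =
      fps_const (s - 1) * fps_deriv (fps_expansion log_g 0) * fps_expansion (g_power s) 0"
    by (rule fps_expansion_log_derivative[OF g_power_holomorphic]) (simp add: g_power_def)
  moreover have "fps_deriv (fps_expansion g 0) =
      fps_const 1 * fps_deriv (fps_expansion log_g 0) * fps_expansion g 0"
    by (rule fps_expansion_log_derivative[OF g_holomorphic]) (simp add: exp_log_g)
  ultimately show ?thesis
    by (simp add: algebra_simps)
qed

lemma fps_expansion_log_ode: "(1 - fps_X) * fps_deriv (fps_X * fps_expansion g 0) = 1"
proof (rule fps_expansion_unique_complex)
  note [fps_expansion_intros] = holomorphic_has_fps_expansion[OF g_holomorphic]
  show "(\<lambda>t. (1 - t) * deriv (\<lambda>t. t * g t) t) has_fps_expansion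
      (1 - fps_X) * fps_deriv (fps_X * fps_expansion g 0)"
    by (intro fps_expansion_intros)
  have "(1 - t) * deriv (\<lambda>t. t * g t) t = 1" if t: "t \<in> ball 0 1" for t
  proof -
    have eq: "(\<lambda>t. t * g t) = (\<lambda>t. - ln (1 - t))"
      by (auto simp: g_def fun_eq_iff)
    have nz: "1 - t \<noteq> 0"
      using t by auto
    have "((\<lambda>t. - ln (1 - t)) has_field_derivative 1 / (1 - t)) (at t)"
      using one_minus_notin_nonpos_Reals[OF t] nz
      by (auto intro!: derivative_eq_intros simp: field_simps)
    then have "deriv (\<lambda>t. t * g t) t = 1 / (1 - t)"
      unfolding eq by (rule DERIV_imp_deriv)
    with nz show ?thesis
      by simp
  qed
  then show "(\<lambda>t. (1 - t) * deriv (\<lambda>t. t * g t) t) has_fps_expansion 1"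
    by (subst has_fps_expansion_cong[OF _ refl, where g = "\<lambda>_. 1"])
      (auto intro: eventually_mono[OF eventually_in_disc])
qed

section \<open>The coefficients of the powers of g\<close>

theorem mainTheorem3:
  fixes s :: complex
  shows "alpha 0 s = 1 \<and> alpha 1 s = (s - 1) / 2 \<and>
    (\<forall>k::nat. k \<ge> 1 \<longrightarrow>
      alpha (k + 1) s =
        1 / (of_nat k * (of_nat k + 1) * (of_nat k + 2)) *
        (\<Sum>j = 1..k. alpha j s * of_nat j *
            (of_nat k + of_nat k ^ 2 + s * (2 * of_nat k + 2 - of_nat j)) /
            ((of_nat k - of_nat j + 1) * (of_nat k - of_nat j + 2))))"
proof -
  define F where "F = fps_expansion (g_power s) 0"
  define G where "G = fps_expansion g 0"
  have alpha: "alpha k s = fps_nth F k" for k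
    by (simp add: alpha_def F_def fps_expansion_def)
  note power = fps_expansion_power_ode[of s, folded F_def G_def]
  note log = fps_expansion_log_ode[folded G_def]
  have alpha_0: "alpha 0 s = 1"
    by (simp add: alpha_def g_power_def log_g_0)
  moreover have "alpha 1 s = (s - 1) / 2"
    \<comment> \<open>the constant coefficient of the power rule\<close>
    using arg_cong[OF power, of "\<lambda>f. fps_nth f 0"] alpha_0
    by (simp add: alpha log_ode_coeff[OF log])
  moreover have "alpha (k + 1) s =
        1 / (of_nat k * (of_nat k + 1) * (of_nat k + 2)) *
        (\<Sum>j = 1..k. alpha j s * of_nat j *
            (of_nat k + of_nat k ^ 2 + s * (2 * of_nat k + 2 - of_nat j)) /
            ((of_nat k - of_nat j + 1) * (of_nat k - of_nat j + 2)))" if "k \<ge> 1" for k :: nat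
  proof -
    have "of_nat k * (of_nat k + 1) * (of_nat k + 2) \<noteq> (0::complex)"
      using that of_nat_add_neq_0[of k, where 'a=complex] by simp
    then show ?thesis
      unfolding alpha log_power_recurrence[OF power log] by simp
  qed
  ultimately show ?thesis
    by blast
qed

end
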